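(* The operators $\mathcal{K}_\ell=\sum_{E\in\mathfrak{K}_\ell}X(E)^2$, $\ell=1,\dots,7$, acting on $\mathbb{S}^7$, pairwise commute. Moreover, they commute with the sublaplacian $\Delta^{\mathrm{sub}}_{\mathrm{T},6}=-\sum_{j=1}^6X(A_j)^2$.
   Context: Let $A_1,\dots,A_7\in\mathfrak{so}(8)$ be a fixed family of real skew-symmetric $8\times 8$ matrices with $A_iA_j+A_jA_i=-2\delta_{ij}I$ for $i,j=1,\dots,7$. For $A=(a_{lk})\in\mathfrak{so}(8)$ let $X(A)=\sum_{l,k=1}^8a_{lk}x_k\frac{\partial}{\partial x_l}$, a linear vector field on $\mathbb{R}^8$ tangent to the unit sphere $\mathbb{S}^7$; its restriction to $\mathbb{S}^7$ is denoted by the same symbol and regarded as a first order differential operator on $C^\infty(\mathbb{S}^7)$. The generating sets are $\mathfrak{K}_\ell=\{A_iA_j : 1\le i<j\le\ell+1\}$ for $1\le\ell\le5$; $\mathfrak{K}_6=\{A_iA_j : 1\le i<j\le6\}\cup\{A_7\}$; $\mathfrak{K}_7=\{A_iA_j : 1\le i<j\le7\}\cup\{A_k : 1\le k\le7\}$. *)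

theory Defs
  imports "HOL-Analysis.Analysis"
begin

fun Ck_on :: "nat \<Rightarrow> 'a::real_normed_vector set \<Rightarrow> ('a \<Rightarrow> real) \<Rightarrow> bool" where
  "Ck_on 0 U g \<longleftrightarrow> continuous_on U g"
| "Ck_on (Suc k) U g \<longleftrightarrow>
     (\<forall>x\<in>U. g differentiable (at x)) \<and>
     (\<forall>v. Ck_on k U (\<lambda>x. frechet_derivative g (at x) v))"

definition smooth_on :: "'a::real_normed_vector set \<Rightarrow> ('a \<Rightarrow> real) \<Rightarrow> bool" where
  "smooth_on U g \<longleftrightarrow> open U \<and> (\<forall>k. Ck_on k U g)"

abbreviation S7 :: "(real^8) set" where
  "S7 \<equiv> sphere 0 1"

text \<open>
  Functions on the sphere are represented by functions on the ambient space whose values off the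
  sphere are irrelevant.  As usual for an embedded submanifold, they are smooth if they
  extend smoothly to an open neighbourhood.
\<close>

definition smooth_extension :: "(real^8 \<Rightarrow> real) \<Rightarrow> (real^8 \<Rightarrow> real) \<Rightarrow> bool" where
  "smooth_extension f g \<longleftrightarrow> (\<exists>U. S7 \<subseteq> U \<and> smooth_on U g) \<and> (\<forall>x\<in>S7. g x = f x)"

definition C_inf_S7 :: "(real^8 \<Rightarrow> real) set" where
  "C_inf_S7 = {f. \<exists>g. smooth_extension f g}"

definition linear_field :: "real^8^8 \<Rightarrow> (real^8 \<Rightarrow> real) \<Rightarrow> real^8 \<Rightarrow> real" where
  "linear_field A g x =
     (\<Sum>l\<in>UNIV. \<Sum>k\<in>UNIV. A $ l $ k * x $ k * frechet_derivative g (at x) (axis l 1))"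

text \<open>
  The restriction of the linear field to the sphere: differentiate any smooth extension.  For
  skew-symmetric matrices, the field is tangent to the sphere and the choice of the
  extension is immaterial, see \<open>sphere_field_eq\<close> below.
\<close>

definition sphere_field :: "real^8^8 \<Rightarrow> (real^8 \<Rightarrow> real) \<Rightarrow> real^8 \<Rightarrow> real" where
  "sphere_field A f = linear_field A (SOME g. smooth_extension f g)"

definition gen_set :: "(nat \<Rightarrow> real^8^8) \<Rightarrow> nat \<Rightarrow> (real^8^8) set" where
  "gen_set A l =
     (if l \<le> 5 then {A i ** A j | i j. 1 \<le> i \<and> i < j \<and> j \<le> l + 1}
      else if l = 6 then {A i ** A j | i j. 1 \<le> i \<and> i < j \<and> j \<le> 6} \<union> {A 7}
      else {A i ** A j | i j. 1 \<le> i \<and> i < j \<and> j \<le> 7} \<union> {A k | k. 1 \<le> k \<and> k \<le> 7})"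

definition K_op :: "(nat \<Rightarrow> real^8^8) \<Rightarrow> nat \<Rightarrow> (real^8 \<Rightarrow> real) \<Rightarrow> real^8 \<Rightarrow> real" where
  "K_op A l f x = (\<Sum>E\<in>gen_set A l. (sphere_field E ^^ 2) f x)"

definition sublaplacian_T6 :: "(nat \<Rightarrow> real^8^8) \<Rightarrow> (real^8 \<Rightarrow> real) \<Rightarrow> real^8 \<Rightarrow> real" where
  "sublaplacian_T6 A f x = - (\<Sum>j=1..6. (sphere_field (A j) ^^ 2) f x)"

definition commute_on_S7 ::
    "((real^8 \<Rightarrow> real) \<Rightarrow> real^8 \<Rightarrow> real) \<Rightarrow> ((real^8 \<Rightarrow> real) \<Rightarrow> real^8 \<Rightarrow> real) \<Rightarrow> bool" where
  "commute_on_S7 P Q \<longleftrightarrow> (\<forall>f\<in>C_inf_S7. \<forall>x\<in>S7. P (Q f) x = Q (P f) x)"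

lemma linear_field_eq_frechet_derivative:
  assumes "g differentiable (at x)"
  shows "linear_field A g x = frechet_derivative g (at x) (A *v x)"
proof -
  interpret D: linear "frechet_derivative g (at x)"
    using assms by (rule linear_frechet_derivative)
  have "frechet_derivative g (at x) (A *v x) =
      frechet_derivative g (at x) (\<Sum>l\<in>UNIV. (A *v x) $ l *\<^sub>R axis l 1)"
    using basis_expansion[of "A *v x"] by (simp add: scalar_mult_eq_scaleR)
  also have "\<dots> = (\<Sum>l\<in>UNIV. (A *v x) $ l * frechet_derivative g (at x) (axis l 1))"
    by (simp add: D.sum D.scaleR)
  also have "\<dots> = linear_field A g x"
    by (simp add: linear_field_def matrix_vector_mult_def sum_distrib_right)
  finally show ?thesis by simp
qed

lemma skew_inner_eq_0:
  fixes A :: "real^8^8"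
  assumes "transpose A = - A"
  shows "x \<bullet> (A *v x) = 0"
proof -
  have "x \<bullet> (A *v x) = (transpose A *v x) \<bullet> x"
    by (simp add: dot_lmul_matrix transpose_matrix_vector)
  also have "\<dots> = - (x \<bullet> (A *v x))"
    using assms scaleR_matrix_vector_assoc[of "- 1" A x, symmetric]
    by (simp add: inner_commute)
  finally show ?thesis by simp
qed

lemma frechet_derivative_tangent_cong:
  fixes g h :: "real^8 \<Rightarrow> real"
  assumes g: "g differentiable (at x)" and h: "h differentiable (at x)"
    and eq: "\<And>y. y \<in> S7 \<Longrightarrow> g y = h y" and x: "x \<in> S7" and orth: "x \<bullet> v = 0"
  shows "frechet_derivative g (at x) v = frechet_derivative h (at x) v"
proof (cases "v = 0")
  case True
  then show ?thesis
    using g h by (metis linear_0 linear_frechet_derivative)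
next
  case False
  define c where "c t = cos (t * norm v) *\<^sub>R x + (sin (t * norm v) / norm v) *\<^sub>R v" for t
  have c0: "c 0 = x" by (simp add: c_def)
  have "c t \<in> S7" for t
  proof -
    have "norm (c t) ^ 2 = (cos (t * norm v))\<^sup>2 * (x \<bullet> x)
        + (sin (t * norm v) / norm v)\<^sup>2 * (v \<bullet> v)"
      unfolding power2_norm_eq_inner c_def
      using orth by (simp add: inner_add_left inner_add_right inner_commute power2_eq_square)
    also have "\<dots> = 1"
      using x False by (simp add: power_divide flip: power2_norm_eq_inner)
    finally show ?thesis
      by (simp add: power2_eq_1_iff) (smt (verit) norm_ge_zero)
  qed
  then have gh: "g \<circ> c = h \<circ> c" using eq by (auto simp: fun_eq_iff)
  have c': "(c has_derivative (\<lambda>t. t *\<^sub>R v)) (at 0)"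
    unfolding c_def using False by (auto intro!: derivative_eq_intros simp: fun_eq_iff)
  have "((g \<circ> c) has_derivative (frechet_derivative g (at x) \<circ> (\<lambda>t. t *\<^sub>R v))) (at 0)"
    by (rule diff_chain_at[OF c']) (use g c0 in \<open>simp add: frechet_derivative_works\<close>)
  moreover have "((h \<circ> c) has_derivative (frechet_derivative h (at x) \<circ> (\<lambda>t. t *\<^sub>R v))) (at 0)"
    by (rule diff_chain_at[OF c']) (use h c0 in \<open>simp add: frechet_derivative_works\<close>)
  ultimately have "frechet_derivative g (at x) \<circ> (\<lambda>t. t *\<^sub>R v) =
      frechet_derivative h (at x) \<circ> (\<lambda>t. t *\<^sub>R v)"
    using has_derivative_unique gh by metis
  from fun_cong[OF this, of 1] show ?thesis by simp
qed

lemma smooth_extension_differentiable: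
  assumes "smooth_extension f g" "x \<in> S7"
  shows "g differentiable (at x)"
proof -
  obtain U where U: "S7 \<subseteq> U" "\<And>k. Ck_on k U g"
    using assms(1) by (auto simp: smooth_extension_def smooth_on_def)
  from U(2)[of "Suc 0"] have "\<forall>x\<in>U. g differentiable (at x)" by (simp del: Ck_on.simps(1))
  then show ?thesis using U(1) assms(2) by blast
qed

lemma sphere_field_eq:
  assumes A: "transpose A = - A" and g: "smooth_extension f g" and x: "x \<in> S7"
  shows "sphere_field A f x = linear_field A g x"
proof -
  define h where "h = (SOME g. smooth_extension f g)"
  have h: "smooth_extension f h" unfolding h_def by (rule someI[of _ g]) (rule g)
  note dg = smooth_extension_differentiable[OF g x]
  note dh = smooth_extension_differentiable[OF h x]
  have "frechet_derivative h (at x) (A *v x) = frechet_derivative g (at x) (A *v x)"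
    by (rule frechet_derivative_tangent_cong[OF dh dg _ x skew_inner_eq_0[OF A]])
      (use g h in \<open>simp add: smooth_extension_def\<close>)
  then show ?thesis
    by (simp add: sphere_field_def flip: h_def)
      (simp add: linear_field_eq_frechet_derivative dg dh)
qed

end

theory Submission
  imports Defs
begin

text \<open>
  Write \<open>X(E)\<close> for the linear field of \<open>E\<close>. Any two generators either commute or anticommute.
  If \<open>E F = - F E\<close>, then
  \<open>[X(E), X(F)\<^sup>2] = -2 (X(EF) X(F) + X(F) X(EF))\<close>, and the first-order part of this operator
  vanishes, so at \<open>x\<close> it is \<open>-4\<close> times the Hessian evaluated at \<open>(EFx, Fx)\<close>. If a generating set is
  stable up to sign under multiplication by \<open>E\<close>, then \<open>F \<mapsto> \<plusminus> EF\<close> pairs off its elements into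
  cancelling terms, because \<open>E\<^sup>2 = -1\<close>; hence \<open>X(E)\<close> commutes with the sum of squares. Since the
  generating sets are nested, all commutation relations follow except the one between \<open>X(A 7)\<close> and
  the sublaplacian. There one needs that the sum over \<open>k \<le> 6\<close> of the Hessian at
  \<open>(A 7 A k x, A k x)\<close> vanishes, which holds since \<open>x, A 1 x, \<dots>, A 7 x\<close> is an orthogonal basis and
  the trace of a skew-symmetric map against a symmetric form is zero.
\<close>

subsection \<open>Smooth functions and symmetry of second derivatives\<close>

text \<open>\<open>Ck_on\<close> differentiates functions defined on the whole space, whereas the
  sum and product rules below hold only at points of \<open>U\<close>. Since \<open>U\<close> is
  open, derivatives there ignore values outside \<open>U\<close>, so the equality passes down the
  induction.\<close>

lemma Ck_on_cong:
  assumes "open U" "\<And>x. x \<in> U \<Longrightarrow> f x = g x" "Ck_on k U f"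
  shows "Ck_on k U g"
  using assms(2,3)
proof (induction k arbitrary: f g)
  case 0
  then show ?case by (metis Ck_on.simps(1) continuous_on_cong)
next
  case (Suc k)
  have diff: "g differentiable (at x)"
    and D: "frechet_derivative g (at x) = frechet_derivative f (at x)" if "x \<in> U" for x
  proof -
    have "f differentiable (at x)" using Suc.prems(2) that by simp
    then have "(f has_derivative frechet_derivative f (at x)) (at x)"
      by (simp add: frechet_derivative_works)
    then have "(g has_derivative frechet_derivative f (at x)) (at x)"
      by (rule has_derivative_transform_within_open[OF _ assms(1) that Suc.prems(1)])
    then show "g differentiable (at x)"
      and "frechet_derivative g (at x) = frechet_derivative f (at x)"
      by (auto intro: differentiableI simp: frechet_derivative_at[symmetric])
  qed
  show ?case
    unfolding Ck_on.simps
  proof (intro conjI allI ballI)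
    fix v
    show "Ck_on k U (\<lambda>x. frechet_derivative g (at x) v)"
      by (rule Suc.IH[of "\<lambda>x. frechet_derivative f (at x) v"]) (use D Suc.prems(2) in auto)
  qed (rule diff)
qed

lemma Ck_on_differentiable: "Ck_on (Suc k) U f \<Longrightarrow> x \<in> U \<Longrightarrow> f differentiable (at x)"
  by simp

lemma Ck_on_SucD: "Ck_on (Suc k) U f \<Longrightarrow> Ck_on k U f"
proof (induction k arbitrary: f)
  case 0
  then show ?case
    by (auto simp: differentiable_imp_continuous_within intro!: continuous_at_imp_continuous_on)
qed auto

lemma Ck_on_const: "Ck_on k U (\<lambda>x. c)"
  by (induction k arbitrary: c) auto

lemma Ck_on_bounded_linear:
  assumes "bounded_linear L"
  shows "Ck_on k U L"
proof (cases k)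
  case 0
  then show ?thesis using assms by (simp add: linear_continuous_on)
next
  case (Suc j)
  have "frechet_derivative L (at x) = L" for x
    using frechet_derivative_at[OF bounded_linear_imp_has_derivative[OF assms]] by simp
  then show ?thesis
    using Suc assms by (simp add: Ck_on_const bounded_linear_imp_differentiable)
qed

lemma Ck_on_add:
  assumes "open U" "Ck_on k U f" "Ck_on k U g"
  shows "Ck_on k U (\<lambda>x. f x + g x)"
  using assms(2,3)
proof (induction k arbitrary: f g)
  case 0
  then show ?case by (simp add: continuous_on_add)
next
  case (Suc k)
  have D: "frechet_derivative (\<lambda>x. f x + g x) (at x) v =
      frechet_derivative f (at x) v + frechet_derivative g (at x) v" if "x \<in> U" for x v
  proof -
    have "(f has_derivative frechet_derivative f (at x)) (at x)"
      and "(g has_derivative frechet_derivative g (at x)) (at x)"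
      using Suc.prems that by (simp_all add: frechet_derivative_works)
    from frechet_derivative_at[OF has_derivative_add[OF this]] show ?thesis by metis
  qed
  have "Ck_on k U (\<lambda>x. frechet_derivative (\<lambda>x. f x + g x) (at x) v)" for v
    by (rule Ck_on_cong[OF assms(1) D[symmetric]]) (use Suc in auto)
  then show ?case using Suc.prems by simp
qed

lemma Ck_on_mult:
  fixes f g :: "'a::real_normed_vector \<Rightarrow> real"
  assumes "open U" "Ck_on k U f" "Ck_on k U g"
  shows "Ck_on k U (\<lambda>x. f x * g x)"
  using assms(2,3)
proof (induction k arbitrary: f g)
  case 0
  then show ?case by (simp add: continuous_on_mult)
next
  case (Suc k)
  have D: "frechet_derivative (\<lambda>x. f x * g x) (at x) v =
      f x * frechet_derivative g (at x) v + frechet_derivative f (at x) v * g x"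
    if "x \<in> U" for x v
  proof -
    have "(f has_derivative frechet_derivative f (at x)) (at x)"
      and "(g has_derivative frechet_derivative g (at x)) (at x)"
      using Suc.prems that by (simp_all add: frechet_derivative_works)
    from frechet_derivative_at[OF has_derivative_mult[OF this]] show ?thesis by metis
  qed
  \<comment> \<open>The product rule leaves one factor undifferentiated; \<open>Ck_on_SucD\<close>
    lowers its order to \<open>k\<close> before the induction hypothesis applies.\<close>
  have "Ck_on k U (\<lambda>x. frechet_derivative (\<lambda>x. f x * g x) (at x) v)" for v
    by (rule Ck_on_cong[OF assms(1) D[symmetric]], assumption,
        intro Ck_on_add[OF assms(1)] Suc.IH Ck_on_SucD[OF Suc.prems(1)] Ck_on_SucD[OF Suc.prems(2)])
      (use Suc.prems in auto)
  then show ?case using Suc.prems by simp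
qed

lemma smooth_on_open: "smooth_on U f \<Longrightarrow> open U"
  by (simp add: smooth_on_def)

lemma smooth_on_differentiable:
  assumes "smooth_on U f" "x \<in> U"
  shows "f differentiable (at x)"
  using assms Ck_on_differentiable unfolding smooth_on_def by blast

lemma smooth_on_frechet_derivative:
  assumes "smooth_on U f"
  shows "smooth_on U (\<lambda>x. frechet_derivative f (at x) v)"
proof -
  have "Ck_on k U (\<lambda>x. frechet_derivative f (at x) v)" for k
    using assms unfolding smooth_on_def by (metis Ck_on.simps(2))
  then show ?thesis using assms by (simp add: smooth_on_def)
qed

lemma smooth_on_continuous: "smooth_on U f \<Longrightarrow> continuous_on U f"
  unfolding smooth_on_def by (metis Ck_on.simps(1))

lemma smooth_on_const: "open U \<Longrightarrow> smooth_on U (\<lambda>x. c)"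
  by (simp add: smooth_on_def Ck_on_const)

lemma smooth_on_bounded_linear: "open U \<Longrightarrow> bounded_linear L \<Longrightarrow> smooth_on U L"
  by (simp add: smooth_on_def Ck_on_bounded_linear)

lemma smooth_on_add: "smooth_on U f \<Longrightarrow> smooth_on U g \<Longrightarrow> smooth_on U (\<lambda>x. f x + g x)"
  by (simp add: smooth_on_def Ck_on_add)

lemma smooth_on_mult: "smooth_on U f \<Longrightarrow> smooth_on U g \<Longrightarrow> smooth_on U (\<lambda>x. f x * g x)"
  by (simp add: smooth_on_def Ck_on_mult)

lemma smooth_on_sum:
  assumes "open U" "\<And>i. i \<in> I \<Longrightarrow> smooth_on U (f i)"
  shows "smooth_on U (\<lambda>x. \<Sum>i\<in>I. f i x)"
  using assms(2)
  by (induction I rule: infinite_finite_induct) (auto simp: smooth_on_const smooth_on_add assms(1))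

lemma frechet_derivative_sum:
  fixes f :: "'i \<Rightarrow> 'a::real_normed_vector \<Rightarrow> real"
  assumes "\<And>i. i \<in> I \<Longrightarrow> f i differentiable (at x)"
  shows "frechet_derivative (\<lambda>y. \<Sum>i\<in>I. f i y) (at x) v =
    (\<Sum>i\<in>I. frechet_derivative (f i) (at x) v)"
proof -
  have "((\<lambda>y. \<Sum>i\<in>I. f i y) has_derivative (\<lambda>v. \<Sum>i\<in>I. frechet_derivative (f i) (at x) v)) (at x)"
    using assms by (intro has_derivative_sum) (simp add: frechet_derivative_works)
  from frechet_derivative_at[OF this] show ?thesis by metis
qed

section \<open>Symmetry of mixed second derivatives\<close>

text \<open>The second difference over a parallelogram is the increment of a first difference. One
  mean value argument along \<open>u\<close> and a second along \<open>v\<close> turn it into a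
  mixed derivative at an intermediate point.\<close>

lemma second_difference_mean_value:
  fixes g :: "'a::real_normed_vector \<Rightarrow> real"
  assumes g: "smooth_on U g" and s: "0 < s"
    and sub: "\<And>a b. 0 \<le> a \<Longrightarrow> a \<le> s \<Longrightarrow> 0 \<le> b \<Longrightarrow> b \<le> s \<Longrightarrow> x + a *\<^sub>R u + b *\<^sub>R v \<in> U"
  obtains a b where "0 < a" "a < s" "0 < b" "b < s"
    "g (x + s *\<^sub>R u + s *\<^sub>R v) - g (x + s *\<^sub>R u) - g (x + s *\<^sub>R v) + g x =
      s\<^sup>2 * frechet_derivative (\<lambda>y. frechet_derivative g (at y) u) (at (x + a *\<^sub>R u + b *\<^sub>R v)) v"
proof -
  let ?D = "\<lambda>w f y. frechet_derivative f (at y) w"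
  have line: "((\<lambda>t. f (p + t *\<^sub>R w)) has_real_derivative ?D w f (p + t *\<^sub>R w)) (at t)"
    if f: "smooth_on U f" and p: "p + t *\<^sub>R w \<in> U" for f p w t
  proof -
    have d: "(f has_derivative frechet_derivative f (at (p + t *\<^sub>R w))) (at (p + t *\<^sub>R w))"
      using smooth_on_differentiable[OF f p] by (simp add: frechet_derivative_works)
    have "((\<lambda>t. p + t *\<^sub>R w) has_derivative (\<lambda>r. r *\<^sub>R w)) (at t)"
      by (auto intro!: derivative_eq_intros)
    from diff_chain_at[OF this d]
    have "((\<lambda>t. f (p + t *\<^sub>R w)) has_derivative (\<lambda>r. ?D (r *\<^sub>R w) f (p + t *\<^sub>R w))) (at t)"
      by (simp add: o_def)
    moreover have "?D (r *\<^sub>R w) f (p + t *\<^sub>R w) = ?D w f (p + t *\<^sub>R w) * r" for r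
      using linear_frechet_derivative[OF smooth_on_differentiable[OF f p]]
      by (simp add: linear_scale mult.commute)
    ultimately show ?thesis by (simp add: has_field_derivative_def)
  qed
  \<comment> \<open>\<open>F\<close> is the difference in direction \<open>v\<close>, taken along
    the side in direction \<open>u\<close>; its increment over \<open>[0, s]\<close> is the full
    second difference.\<close>
  define F where "F r = g ((x + s *\<^sub>R v) + r *\<^sub>R u) - g (x + r *\<^sub>R u)" for r
  have "\<exists>a>0. a < s \<and> F s - F 0 =
      (s - 0) * (?D u g ((x + s *\<^sub>R v) + a *\<^sub>R u) - ?D u g (x + a *\<^sub>R u))"
    unfolding F_def
    by (rule MVT2[OF s], intro DERIV_diff line[OF g])
      (use s sub[of _ 0] sub[of _ s] in \<open>auto simp: algebra_simps\<close>)
  then obtain a where a: "0 < a" "a < s" and Fa: "F s - F 0 =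
      s * (?D u g ((x + s *\<^sub>R v) + a *\<^sub>R u) - ?D u g (x + a *\<^sub>R u))"
    by auto
  have "\<exists>b>0. b < s \<and> ?D u g ((x + a *\<^sub>R u) + s *\<^sub>R v) - ?D u g ((x + a *\<^sub>R u) + 0 *\<^sub>R v) =
      (s - 0) * ?D v (?D u g) ((x + a *\<^sub>R u) + b *\<^sub>R v)"
    by (rule MVT2[OF s], intro line smooth_on_frechet_derivative g) (use a sub in auto)
  then obtain b where b: "0 < b" "b < s" and Fb:
    "?D u g ((x + a *\<^sub>R u) + s *\<^sub>R v) - ?D u g (x + a *\<^sub>R u) =
      s * ?D v (?D u g) ((x + a *\<^sub>R u) + b *\<^sub>R v)"
    by auto
  have "F s - F 0 = g (x + s *\<^sub>R u + s *\<^sub>R v) - g (x + s *\<^sub>R u) - g (x + s *\<^sub>R v) + g x"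
    by (simp add: F_def algebra_simps)
  moreover have "F s - F 0 = s\<^sup>2 * ?D v (?D u g) (x + a *\<^sub>R u + b *\<^sub>R v)"
    using Fa Fb by (simp add: power2_eq_square algebra_simps)
  ultimately show ?thesis using that a b by metis
qed

text \<open>The second difference is unchanged when \<open>u\<close> and \<open>v\<close> are
  exchanged. So the two mixed derivatives agree at two, possibly different, points of every small
  parallelogram at \<open>x\<close>, and continuity brings both points to \<open>x\<close>.\<close>

lemma second_derivative_symmetric:
  fixes g :: "'a::real_normed_vector \<Rightarrow> real"
  assumes g: "smooth_on U g" and x: "x \<in> U"
  shows "frechet_derivative (\<lambda>y. frechet_derivative g (at y) u) (at x) v =
    frechet_derivative (\<lambda>y. frechet_derivative g (at y) v) (at x) u"
proof -
  define P where "P y = frechet_derivative (\<lambda>y. frechet_derivative g (at y) u) (at y) v" for y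
  define Q where "Q y = frechet_derivative (\<lambda>y. frechet_derivative g (at y) v) (at y) u" for y
  have PQ: "continuous_on U P" "continuous_on U Q"
    unfolding P_def Q_def by (intro smooth_on_continuous smooth_on_frechet_derivative g)+
  have "open U" using g by (rule smooth_on_open)
  have "\<bar>P x - Q x\<bar> \<le> e" if "e > 0" for e
  proof -
    have "isCont P x" "isCont Q x"
      using PQ \<open>open U\<close> x by (auto simp: continuous_on_eq_continuous_at)
    then have "\<exists>d>0. \<forall>y. dist y x < d \<longrightarrow> dist (P y) (P x) < e / 2"
      "\<exists>d>0. \<forall>y. dist y x < d \<longrightarrow> dist (Q y) (Q x) < e / 2"
      using that unfolding continuous_at_eps_delta by (simp_all only: half_gt_zero)
    then obtain d1 d2 where d: "d1 > 0" "d2 > 0"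
      "\<And>y. dist y x < d1 \<Longrightarrow> dist (P y) (P x) < e / 2"
      "\<And>y. dist y x < d2 \<Longrightarrow> dist (Q y) (Q x) < e / 2"
      by blast
    obtain d3 where d3: "d3 > 0" "ball x d3 \<subseteq> U"
      using \<open>open U\<close> x openE by blast
    define m where "m = min d1 (min d2 d3)"
    \<comment> \<open>The factor 2 keeps the parallelogram strictly within distance \<open>m\<close>
      of \<open>x\<close>; the summand 1 keeps the denominator positive when both directions
      vanish.\<close>
    define s where "s = m / (2 * (norm u + norm v + 1))"
    have m: "m > 0" using d d3 by (simp add: m_def)
    then have s: "s > 0" unfolding s_def by (simp add: add_nonneg_pos)
    have near: "dist (x + a *\<^sub>R u + b *\<^sub>R v) x < m" if "0 \<le> a" "a \<le> s" "0 \<le> b" "b \<le> s" for a b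
    proof -
      have "dist (x + a *\<^sub>R u + b *\<^sub>R v) x = norm (a *\<^sub>R u + b *\<^sub>R v)"
        by (simp add: dist_norm add.assoc)
      also have "\<dots> \<le> a * norm u + b * norm v"
        using norm_triangle_ineq[of "a *\<^sub>R u" "b *\<^sub>R v"] that by simp
      also have "\<dots> \<le> s * (norm u + norm v + 1)"
        using that s by (simp add: distrib_left add_mono mult_right_mono add_increasing2)
      also have "\<dots> = m / 2"
        unfolding s_def using add_nonneg_pos[of "norm u + norm v" 1]
        by (simp add: divide_simps)
      finally show ?thesis using m by simp
    qed
    have inU: "x + a *\<^sub>R u + b *\<^sub>R v \<in> U" if "0 \<le> a" "a \<le> s" "0 \<le> b" "b \<le> s" for a b
      using near[OF that] d3 by (auto simp: m_def dist_commute)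
    obtain a b where ab: "0 < a" "a < s" "0 < b" "b < s"
      "g (x + s *\<^sub>R u + s *\<^sub>R v) - g (x + s *\<^sub>R u) - g (x + s *\<^sub>R v) + g x =
        s\<^sup>2 * P (x + a *\<^sub>R u + b *\<^sub>R v)"
      using second_difference_mean_value[OF g s inU] unfolding P_def by blast
    have inU': "x + b *\<^sub>R v + a *\<^sub>R u \<in> U" if "0 \<le> b" "b \<le> s" "0 \<le> a" "a \<le> s" for a b
      using inU[OF that(3,4,1,2)] by (simp add: algebra_simps)
    obtain b' a' where ab': "0 < b'" "b' < s" "0 < a'" "a' < s"
      "g (x + s *\<^sub>R v + s *\<^sub>R u) - g (x + s *\<^sub>R v) - g (x + s *\<^sub>R u) + g x =
        s\<^sup>2 * Q (x + b' *\<^sub>R v + a' *\<^sub>R u)"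
      using second_difference_mean_value[OF g s inU'] unfolding Q_def by blast
    have "s\<^sup>2 * P (x + a *\<^sub>R u + b *\<^sub>R v) = s\<^sup>2 * Q (x + a' *\<^sub>R u + b' *\<^sub>R v)"
      using ab(5) ab'(5) by (simp add: algebra_simps)
    then have "P (x + a *\<^sub>R u + b *\<^sub>R v) = Q (x + a' *\<^sub>R u + b' *\<^sub>R v)"
      using s by simp
    moreover have "dist (P (x + a *\<^sub>R u + b *\<^sub>R v)) (P x) < e / 2"
      using d(3) near[of a b] ab by (simp add: m_def)
    moreover have "dist (Q (x + a' *\<^sub>R u + b' *\<^sub>R v)) (Q x) < e / 2"
      using d(4) near[of a' b'] ab' by (simp add: m_def)
    ultimately show ?thesis unfolding dist_real_def by linarith
  qed
  then have "P x = Q x" by (metis abs_le_zero_iff dense_ge eq_iff_diff_eq_0)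
  then show ?thesis by (simp add: P_def Q_def)
qed

subsection \<open>Commutators of linear fields\<close>

lemma smooth_on_linear_field:
  assumes "smooth_on U g"
  shows "smooth_on U (linear_field A g)"
proof -
  note op = smooth_on_open[OF assms]
  have "linear_field A g = (\<lambda>x. \<Sum>l\<in>UNIV. \<Sum>k\<in>UNIV.
      A $ l $ k * x $ k * frechet_derivative g (at x) (axis l 1))"
    by (rule ext) (rule linear_field_def)
  then show ?thesis
    by (simp only:) (intro smooth_on_sum smooth_on_mult smooth_on_const smooth_on_frechet_derivative
        smooth_on_bounded_linear[OF _ bounded_linear_vec_nth] assms op)
qed

lemma linear_field_cong:
  assumes "smooth_on U f" "\<And>y. y \<in> U \<Longrightarrow> f y = g y" "x \<in> U"
  shows "linear_field A f x = linear_field A g x"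
proof -
  have "frechet_derivative f (at x) = frechet_derivative g (at x)"
    using frechet_derivative_transform_within_open[of f x U g]
      smooth_on_differentiable[OF assms(1,3)] smooth_on_open[OF assms(1)] assms by blast
  then show ?thesis by (simp add: linear_field_def)
qed

lemma linear_field_sum:
  assumes "\<And>i. i \<in> I \<Longrightarrow> smooth_on U (f i)" "x \<in> U"
  shows "linear_field A (\<lambda>y. \<Sum>i\<in>I. f i y) x = (\<Sum>i\<in>I. linear_field A (f i) x)"
proof -
  have "frechet_derivative (\<lambda>y. \<Sum>i\<in>I. f i y) (at x) v =
      (\<Sum>i\<in>I. frechet_derivative (f i) (at x) v)" for v
    by (rule frechet_derivative_sum) (rule smooth_on_differentiable[OF assms(1) assms(2)])
  then show ?thesis
    by (simp add: linear_field_def sum_distrib_left sum.swap[of _ I])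
qed

lemma linear_field_minus:
  assumes "smooth_on U f" "x \<in> U"
  shows "linear_field A (\<lambda>y. - f y) x = - linear_field A f x"
proof -
  have "(f has_derivative frechet_derivative f (at x)) (at x)"
    using smooth_on_differentiable[OF assms] by (simp add: frechet_derivative_works)
  from frechet_derivative_at[OF has_derivative_minus[OF this]]
  have "frechet_derivative (\<lambda>y. - f y) (at x) v = - frechet_derivative f (at x) v" for v
    by metis
  then show ?thesis by (simp add: linear_field_def sum_negf)
qed

lemma linear_field_lincomb:
  assumes "smooth_on U f" "smooth_on U g" "x \<in> U"
  shows "linear_field A (\<lambda>y. f y + c * g y) x = linear_field A f x + c * linear_field A g x"
proof -
  have "(f has_derivative frechet_derivative f (at x)) (at x)"
    and "(g has_derivative frechet_derivative g (at x)) (at x)"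
    using smooth_on_differentiable[OF assms(1,3)] smooth_on_differentiable[OF assms(2,3)]
    by (simp_all add: frechet_derivative_works)
  from frechet_derivative_at[OF has_derivative_add[OF this(1) has_derivative_mult_right[OF this(2)]]]
  have "frechet_derivative (\<lambda>y. f y + c * g y) (at x) v =
      frechet_derivative f (at x) v + c * frechet_derivative g (at x) v" for v
    by (rule fun_cong[OF sym])
  then show ?thesis
    by (simp add: linear_field_def sum.distrib sum_distrib_left distrib_left mult.left_commute)
qed

section \<open>Second derivatives along linear fields\<close>

lemma linear_sum_matrix_axis:
  fixes f :: "real^8 \<Rightarrow> real"
  assumes "linear f"
  shows "(\<Sum>l\<in>UNIV. \<Sum>k\<in>UNIV. B $ l $ k * y $ k * f (axis l 1)) = f (B *v y)"
proof -
  interpret linear f by fact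
  have "f (B *v y) = f (\<Sum>l\<in>UNIV. (B *v y) $ l *\<^sub>R axis l 1)"
    using basis_expansion[of "B *v y"] by (simp add: scalar_mult_eq_scaleR)
  also have "\<dots> = (\<Sum>l\<in>UNIV. (B *v y) $ l * f (axis l 1))"
    by (simp add: sum scaleR)
  finally show ?thesis by (simp add: matrix_vector_mult_def sum_distrib_right)
qed

text \<open>Both directions are constant vectors. The contribution of a direction that moves with
  the base point is the separate first-order term in
  \<open>linear_field_linear_field\<close>.\<close>

definition hessian :: "(real^8 \<Rightarrow> real) \<Rightarrow> real^8 \<Rightarrow> real^8 \<Rightarrow> real^8 \<Rightarrow> real" where
  "hessian g x v w = frechet_derivative (\<lambda>y. frechet_derivative g (at y) w) (at x) v"

lemma hessian_sym: "smooth_on U g \<Longrightarrow> x \<in> U \<Longrightarrow> hessian g x v w = hessian g x w v"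
  unfolding hessian_def by (rule second_derivative_symmetric)

text \<open>The first slot is the argument of a derivative, hence linear; symmetry carries linearity
  over to the second.\<close>

lemma bilinear_hessian:
  assumes "smooth_on U g" "x \<in> U"
  shows "bilinear (hessian g x)"
proof -
  have "linear (\<lambda>v. hessian g x v w)" for w
    unfolding hessian_def
    by (rule linear_frechet_derivative,
        rule smooth_on_differentiable[OF smooth_on_frechet_derivative[OF assms(1)] assms(2)])
  moreover from this have "linear (hessian g x v)" for v
    by (subst hessian_sym[OF assms, abs_def])
  ultimately show ?thesis by (simp add: bilinear_def)
qed

text \<open>Differentiate \<open>Dg(y)(B y)\<close> along \<open>A x\<close>: the derivative falls
  on \<open>Dg\<close>, giving the Hessian, or on \<open>B y\<close>, giving \<open>B A x\<close>.
  This is why the matrices appear in reversed order.\<close>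

lemma linear_field_linear_field:
  assumes g: "smooth_on U g" and x: "x \<in> U"
  shows "linear_field A (linear_field B g) x =
    hessian g x (A *v x) (B *v x) + frechet_derivative g (at x) ((B ** A) *v x)"
proof -
  let ?D = "frechet_derivative g (at x)"
  define G where "G l k y = B $ l $ k * y $ k * frechet_derivative g (at y) (axis l 1)" for l k y
  have B: "linear_field B g = (\<lambda>y. \<Sum>l\<in>UNIV. \<Sum>k\<in>UNIV. G l k y)"
    unfolding G_def by (rule ext) (rule linear_field_def)
  have G: "(G l k has_derivative (\<lambda>v. B $ l $ k * x $ k * hessian g x v (axis l 1) +
      B $ l $ k * v $ k * ?D (axis l 1))) (at x)" for l k
  proof -
    have "((\<lambda>y. frechet_derivative g (at y) (axis l 1)) has_derivative
        (\<lambda>v. hessian g x v (axis l 1))) (at x)"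
      using smooth_on_differentiable[OF smooth_on_frechet_derivative[OF g] x]
      unfolding hessian_def by (simp add: frechet_derivative_works)
    moreover have "((\<lambda>y. B $ l $ k * y $ k) has_derivative (\<lambda>v. B $ l $ k * v $ k)) (at x)"
      by (intro bounded_linear_imp_has_derivative bounded_linear_const_mult bounded_linear_vec_nth)
    ultimately show ?thesis
      unfolding G_def by (rule has_derivative_mult[rotated])
  qed
  have "((\<lambda>y. \<Sum>l\<in>UNIV. \<Sum>k\<in>UNIV. G l k y) has_derivative
      (\<lambda>v. \<Sum>l\<in>UNIV. \<Sum>k\<in>UNIV. B $ l $ k * x $ k * hessian g x v (axis l 1) +
      B $ l $ k * v $ k * ?D (axis l 1))) (at x)"
    by (intro has_derivative_sum G)
  from frechet_derivative_at[OF this]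
  have "frechet_derivative (linear_field B g) (at x) v =
      (\<Sum>l\<in>UNIV. \<Sum>k\<in>UNIV. B $ l $ k * x $ k * hessian g x v (axis l 1)) +
      (\<Sum>l\<in>UNIV. \<Sum>k\<in>UNIV. B $ l $ k * v $ k * ?D (axis l 1))" for v
    unfolding B by (simp add: sum.distrib fun_eq_iff)
  also have "\<dots> v = hessian g x v (B *v x) + ?D (B *v v)" for v
    using bilinear_hessian[OF g x] linear_frechet_derivative[OF smooth_on_differentiable[OF g x]]
    by (simp add: linear_sum_matrix_axis bilinear_def)
  finally show ?thesis
    using smooth_on_differentiable[OF smooth_on_linear_field[OF g] x]
    by (simp add: linear_field_eq_frechet_derivative matrix_vector_mul_assoc)
qed

lemma linear_field_commute:
  assumes "smooth_on U g" "x \<in> U" "A ** B = B ** A"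
  shows "linear_field A (linear_field B g) x = linear_field B (linear_field A g) x"
  using hessian_sym[OF assms(1,2)] assms(3)
  by (simp add: linear_field_linear_field[OF assms(1,2)])

lemma matrix_mult_minus_left: "(- A) ** B = - (A ** B :: real^'n^'m)"
  by (simp add: vec_eq_iff matrix_matrix_mult_def sum_negf)

lemma matrix_mult_minus_right: "A ** (- B) = - (A ** B :: real^'n^'m)"
  by (simp add: vec_eq_iff matrix_matrix_mult_def sum_negf)

lemma matrix_vector_mult_minus_left: "(- A) *v x = - (A *v x :: real^'m)"
  by (simp add: vec_eq_iff matrix_vector_mult_def sum_negf)

lemmas matrix_minus = matrix_mult_minus_left matrix_mult_minus_right matrix_vector_mult_minus_left

text \<open>The Hessian parts agree by symmetry. The first-order parts are the derivatives along
  \<open>B A x = - A B x\<close> and along \<open>A B x\<close>, which differ by \<open>-2\<close>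
  times the latter.\<close>

lemma linear_field_anticommute:
  assumes "smooth_on U g" "x \<in> U" "A ** B = - (B ** A)"
  shows "linear_field A (linear_field B g) x =
    linear_field B (linear_field A g) x - 2 * linear_field (A ** B) g x"
proof -
  note d = smooth_on_differentiable[OF assms(1,2)]
  have "frechet_derivative g (at x) (- v) = - frechet_derivative g (at x) v" for v
    using linear_frechet_derivative[OF d] by (rule linear_neg)
  moreover have "B ** A = - (A ** B)" using assms(3) by simp
  ultimately show ?thesis
    using hessian_sym[OF assms(1,2), of "A *v x" "B *v x"]
    by (simp add: linear_field_linear_field[OF assms(1,2)] linear_field_eq_frechet_derivative[OF d]
        matrix_minus)
qed

section \<open>Commutators with sums of squares\<close>

definition sum_squares :: "(real^8^8) set \<Rightarrow> (real^8 \<Rightarrow> real) \<Rightarrow> real^8 \<Rightarrow> real" where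
  "sum_squares S g x = (\<Sum>F\<in>S. linear_field F (linear_field F g) x)"

lemma smooth_on_sum_squares: "smooth_on U g \<Longrightarrow> smooth_on U (sum_squares S g)"
  unfolding sum_squares_def[abs_def]
  by (intro smooth_on_sum smooth_on_linear_field smooth_on_open[of U g])

text \<open>\<open>E\<close> is moved past the two copies of \<open>F\<close> one at a time, and
  each move leaves a term containing \<open>E ** F\<close>.\<close>

lemma linear_field_square_commutator:
  assumes g: "smooth_on U g" and x: "x \<in> U" and anti: "E ** F = - (F ** E)"
  shows "linear_field E (linear_field F (linear_field F g)) x =
    linear_field F (linear_field F (linear_field E g)) x - 4 * hessian g x ((E ** F) *v x) (F *v x)"
proof -
  note d = smooth_on_differentiable[OF g x]
  note sm = smooth_on_linear_field[OF g]
  \<comment> \<open>The inner exchange holds on all of \<open>U\<close>, so it may be differentiated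
    along \<open>F\<close>.\<close>
  have "linear_field F (linear_field E (linear_field F g)) x =
      linear_field F (\<lambda>y. linear_field F (linear_field E g) y + (-2) * linear_field (E ** F) g y) x"
    using linear_field_anticommute[OF g _ anti]
    by (intro linear_field_cong[OF smooth_on_linear_field[OF sm] _ x]) simp
  also have "\<dots> = linear_field F (linear_field F (linear_field E g)) x -
      2 * linear_field F (linear_field (E ** F) g) x"
    using linear_field_lincomb[OF smooth_on_linear_field[OF sm] sm x, of F F E "-2" "E ** F"] by simp
  finally have "linear_field E (linear_field F (linear_field F g)) x =
      linear_field F (linear_field F (linear_field E g)) x -
      2 * (linear_field F (linear_field (E ** F) g) x + linear_field (E ** F) (linear_field F g) x)"
    using linear_field_anticommute[OF sm x anti] by simp
  \<comment> \<open>\<open>E ** F\<close> anticommutes with \<open>F\<close> too, so the first-order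
    parts of the two remaining products are opposite and only the Hessian survives.\<close>
  moreover have "(E ** F) ** F = - (F ** (E ** F))"
    by (subst anti) (simp only: matrix_mul_assoc matrix_minus)
  moreover have "frechet_derivative g (at x) (- v) = - frechet_derivative g (at x) v" for v
    using linear_frechet_derivative[OF d] by (rule linear_neg)
  ultimately show ?thesis
    using hessian_sym[OF g x, of "F *v x" "(E ** F) *v x"]
    by (simp add: linear_field_linear_field[OF g x] matrix_minus)
qed

text \<open>The first-order terms cancel, which reduces commutation to a statement on the Hessian.\<close>

lemma linear_field_sum_squares_commute:
  assumes g: "smooth_on U g" and x: "x \<in> U"
    and comm: "\<And>F. F \<in> S \<Longrightarrow> E ** F = F ** E \<or> E ** F = - (F ** E)"
    and hess: "(\<Sum>F\<in>S. if E ** F = F ** E then 0 else hessian g x ((E ** F) *v x) (F *v x)) = 0"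
  shows "linear_field E (sum_squares S g) x = sum_squares S (linear_field E g) x"
proof -
  note sm = smooth_on_linear_field[OF g]
  have 1: "linear_field E (linear_field F (linear_field F g)) x =
      linear_field F (linear_field F (linear_field E g)) x -
      4 * (if E ** F = F ** E then 0 else hessian g x ((E ** F) *v x) (F *v x))" if "F \<in> S" for F
  proof (cases "E ** F = F ** E")
    case True
    have "linear_field E (linear_field F (linear_field F g)) x =
        linear_field F (linear_field E (linear_field F g)) x"
      by (rule linear_field_commute[OF sm x True])
    also have "\<dots> = linear_field F (linear_field F (linear_field E g)) x"
      by (rule linear_field_cong[OF smooth_on_linear_field[OF sm] linear_field_commute[OF g _ True] x])
    finally show ?thesis using True by simp
  next
    case False
    then show ?thesis
      using linear_field_square_commutator[OF g x, of E F] comm[OF that] by simp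
  qed
  have "linear_field E (sum_squares S g) x =
      (\<Sum>F\<in>S. linear_field E (linear_field F (linear_field F g)) x)"
    unfolding sum_squares_def[abs_def] by (rule linear_field_sum[OF smooth_on_linear_field[OF sm] x])
  also have "\<dots> = sum_squares S (linear_field E g) x - 4 * 0"
    by (simp only: 1 sum_subtractf sum_distrib_left[symmetric] hess sum_squares_def cong: sum.cong)
  finally show ?thesis by simp
qed

text \<open>Up to sign, left multiplication by \<open>E\<close> is an involution on the members of \<open>S\<close> that
  anticommute with \<open>E\<close>; it reverses the sign of each summand below.\<close>

lemma sum_bilinear_involution:
  fixes H :: "real^'n \<Rightarrow> real^'n \<Rightarrow> real"
  assumes H: "bilinear H" and sym: "\<And>v w. H v w = H w v"
    and E: "E ** E = - mat 1"
    and no_neg: "\<And>F. F \<in> S \<Longrightarrow> - F \<notin> S"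
    and closed: "\<And>F. F \<in> S \<Longrightarrow>
      E ** F = F ** E \<or> E ** F = - (F ** E) \<and> (E ** F \<in> S \<or> - (E ** F) \<in> S)"
  shows "(\<Sum>F\<in>S. if E ** F = F ** E then 0 else H ((E ** F) *v x) (F *v x)) = 0"
proof -
  define t where "t F = (if E ** F = F ** E then 0 else H ((E ** F) *v x) (F *v x))" for F
  define \<sigma> where "\<sigma> F = (if E ** F = F ** E then F else if E ** F \<in> S then E ** F else - (E ** F))" for F
  have EE: "E ** (E ** F) = - F" for F
    by (simp add: matrix_mul_assoc E matrix_minus)
  have *: "\<sigma> F \<in> S \<and> \<sigma> (\<sigma> F) = F \<and> t (\<sigma> F) = - t F" if F: "F \<in> S" for F
  proof (cases "E ** F = F ** E")
    case True
    then show ?thesis using F by (simp add: \<sigma>_def t_def)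
  next
    case False
    with closed[OF F] have anti: "E ** F = - (F ** E)" and mem: "E ** F \<in> S \<or> - (E ** F) \<in> S"
      by auto
    \<comment> \<open>With \<open>EE\<close> this shows that \<open>E ** F\<close> anticommutes with
      \<open>E\<close>; as \<open>- F \<noteq> F\<close>, it does not commute with \<open>E\<close>.
      Hence \<open>\<sigma>\<close> and \<open>t\<close> stay in the anticommuting branch at the
      image.\<close>
    have FE: "(E ** F) ** E = F"
    proof -
      have "F ** E = - (E ** F)" using anti by simp
      then have "E ** (F ** E) = F" by (simp add: matrix_mult_minus_right EE)
      then show ?thesis by (simp add: matrix_mul_assoc)
    qed
    have neq: "- F \<noteq> F" using no_neg[OF F] F by metis
    have sgn: "H ((- F) *v x) ((E ** F) *v x) = - H ((E ** F) *v x) (F *v x)"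
      using sym by (simp add: matrix_minus bilinear_lneg[OF H])
    show ?thesis
    proof (cases "E ** F \<in> S")
      case True
      \<comment> \<open>\<open>E ** (E ** F) = - F\<close> lies outside \<open>S\<close> by
        \<open>no_neg\<close>, so the second application of \<open>\<sigma>\<close> negates it and
        returns \<open>F\<close>.\<close>
      then show ?thesis
        using False F no_neg[OF F] neq sgn by (simp add: \<sigma>_def t_def EE FE)
    next
      case F': False
      with mem have "- (E ** F) \<in> S" by simp
      moreover have "H (F *v x) ((- (E ** F)) *v x) = - H ((E ** F) *v x) (F *v x)"
        using sym by (simp add: matrix_minus bilinear_rneg[OF H])
      ultimately show ?thesis
        using False F F' neq by (simp add: \<sigma>_def t_def EE FE matrix_mult_minus_left matrix_mult_minus_right)
    qed
  qed
  have "sum t S = (\<Sum>F\<in>S. t (\<sigma> F))"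
    by (rule sum.reindex_bij_witness[of _ \<sigma> \<sigma>]) (use * in auto)
  also have "\<dots> = - sum t S" using * by (simp add: sum_negf)
  finally show ?thesis by (simp add: t_def[abs_def])
qed

subsection \<open>Clifford families\<close>

lemma commute_commute_mult:
  fixes Z :: "real^'n^'n"
  assumes "Z ** R = R ** Z" "Z ** S = S ** Z"
  shows "Z ** (R ** S) = (R ** S) ** Z"
  by (metis assms matrix_mul_assoc)

lemma anti_commute_mult:
  fixes Z :: "real^'n^'n"
  assumes "Z ** R = - (R ** Z)" "Z ** S = S ** Z"
  shows "Z ** (R ** S) = - ((R ** S) ** Z)"
  by (metis assms matrix_mul_assoc matrix_mult_minus_left)

lemma commute_anti_mult:
  fixes Z :: "real^'n^'n"
  assumes "Z ** R = R ** Z" "Z ** S = - (S ** Z)"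
  shows "Z ** (R ** S) = - ((R ** S) ** Z)"
  by (metis assms matrix_mul_assoc matrix_mult_minus_right)

lemma anti_anti_mult:
  fixes Z :: "real^'n^'n"
  assumes "Z ** R = - (R ** Z)" "Z ** S = - (S ** Z)"
  shows "Z ** (R ** S) = (R ** S) ** Z"
  by (metis assms matrix_mul_assoc matrix_mult_minus_left matrix_mult_minus_right add.inverse_inverse)

lemma mat_1_neq_0: "(mat 1 :: real^'n^'n) \<noteq> 0"
proof
  assume "(mat 1 :: real^'n^'n) = 0"
  then have "(mat 1 :: real^'n^'n) *v axis undefined 1 = 0" by simp
  then show False by (simp only: matrix_vector_mul_lid axis_eq_0_iff zero_neq_one[symmetric])
qed

locale clifford_family =
  fixes A :: "nat \<Rightarrow> real^8^8"
  assumes skew: "\<And>i. i \<in> {1..7} \<Longrightarrow> transpose (A i) = - A i"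
    and clifford: "\<And>i j. i \<in> {1..7} \<Longrightarrow> j \<in> {1..7} \<Longrightarrow>
      A i ** A j + A j ** A i = (if i = j then - 2 else 0) *\<^sub>R mat 1"
begin

lemma square: "i \<in> {1..7} \<Longrightarrow> A i ** A i = - mat 1"
proof -
  assume "i \<in> {1..7}"
  from clifford[OF this this] have "2 *\<^sub>R (A i ** A i) = 2 *\<^sub>R (- mat 1)"
    by (simp add: scaleR_2)
  then show ?thesis by (simp only: scaleR_cancel_left) simp
qed

lemma anticommute: "i \<in> {1..7} \<Longrightarrow> j \<in> {1..7} \<Longrightarrow> i \<noteq> j \<Longrightarrow> A i ** A j = - (A j ** A i)"
  using clifford[of i j] by (simp add: eq_neg_iff_add_eq_0)

lemma vector_bivector_commute:
  assumes "c \<in> {1..7}" "i \<in> {1..7}" "j \<in> {1..7}" "c \<noteq> i" "c \<noteq> j"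
  shows "A c ** (A i ** A j) = (A i ** A j) ** A c"
  by (intro anti_anti_mult anticommute assms)

lemma vector_bivector_anticommute:
  assumes "c \<in> {i, j}" "i \<in> {1..7}" "j \<in> {1..7}" "i \<noteq> j"
  shows "A c ** (A i ** A j) = - ((A i ** A j) ** A c)"
proof (cases "c = i")
  case True
  then show ?thesis using assms by (intro commute_anti_mult) (auto intro: anticommute)
next
  case False
  then show ?thesis using assms by (intro anti_commute_mult) (auto intro: anticommute)
qed

text \<open>Products of bivectors with a common index are evaluated by turning that index to the
  inside of both factors, at the cost of signs, and cancelling it here.\<close>

lemma contract:
  assumes "i \<in> {1..7}"
  shows "(P ** A i) ** (A i ** Q) = - (P ** Q)"
proof -
  have "(P ** A i) ** (A i ** Q) = (P ** (A i ** A i)) ** Q" by (simp only: matrix_mul_assoc)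
  then show ?thesis using assms by (simp add: square matrix_minus)
qed

lemma contract_left: "i \<in> {1..7} \<Longrightarrow> A i ** (A i ** Q) = - Q"
  using contract[of i "mat 1"] by simp

lemma contract_right: "i \<in> {1..7} \<Longrightarrow> (P ** A i) ** A i = - P"
  using contract[of i P "mat 1"] by simp

section \<open>Bivectors and their action by left multiplication\<close>

text \<open>For \<open>n \<le> 7\<close> these matrices span a copy of the Lie algebra spin(n). The
  parameter counts vectors, so the generating set with index \<open>l \<le> 5\<close> is
  \<open>bivectors (l + 1)\<close>.\<close>

definition bivectors :: "nat \<Rightarrow> (real^8^8) set" where
  "bivectors n = {A i ** A j | i j. 1 \<le> i \<and> i < j \<and> j \<le> n}"

lemma bivectorsI: "1 \<le> i \<Longrightarrow> i < j \<Longrightarrow> j \<le> n \<Longrightarrow> A i ** A j \<in> bivectors n"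
  by (auto simp: bivectors_def)

lemma bivectorsE:
  assumes "E \<in> bivectors n" "n \<le> 7"
  obtains i j where "E = A i ** A j" "i < j" "i \<in> {1..7}" "j \<in> {1..7}" "j \<le> n"
  using assms by (fastforce simp: bivectors_def)

lemma bivectors_mono: "m \<le> n \<Longrightarrow> bivectors m \<subseteq> bivectors n"
  unfolding bivectors_def by (blast intro: le_trans)

text \<open>The condition \<open>closed\<close> of \<open>sum_bilinear_involution\<close> for a
  single \<open>F\<close>. Membership is only up to sign because reordering the indices of a
  bivector costs a sign; keeping \<open>S\<close> separate from \<open>F\<close> allows a product to
  be located in a part of the generating set first.\<close>

definition acts_on :: "real^8^8 \<Rightarrow> (real^8^8) set \<Rightarrow> real^8^8 \<Rightarrow> bool" where
  "acts_on E S F \<longleftrightarrow>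
    E ** F = F ** E \<or> E ** F = - (F ** E) \<and> (E ** F \<in> S \<or> - (E ** F) \<in> S)"

lemma acts_on_mono: "acts_on E S F \<Longrightarrow> S \<subseteq> T \<Longrightarrow> acts_on E T F"
  by (auto simp: acts_on_def)

lemma bivectors_pm:
  assumes "a \<in> {1..7}" "b \<in> {1..7}" "a \<noteq> b" "a \<le> n" "b \<le> n"
  shows "A a ** A b \<in> bivectors n \<or> - (A a ** A b) \<in> bivectors n"
  using assms bivectorsI[of a b n] bivectorsI[of b a n] anticommute[of a b]
  by (cases a b rule: linorder_cases) auto

text \<open>\<open>E\<close> anticommutes with \<open>A c\<close> exactly for its own indices
  \<open>c\<close>. So \<open>E\<close> and \<open>F\<close> commute if they share no index or both,
  and anticommute if they share one; in the latter case the shared index cancels and leaves a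
  bivector on the other two, up to sign.\<close>

lemma acts_on_bivectors:
  assumes "E \<in> bivectors n" "F \<in> bivectors n" "n \<le> 7"
  shows "acts_on E (bivectors n) F"
proof -
  obtain i j where E: "E = A i ** A j" "i < j" "i \<in> {1..7}" "j \<in> {1..7}" "j \<le> n"
    using assms(1,3) by (rule bivectorsE)
  obtain k l where F: "F = A k ** A l" "k < l" "k \<in> {1..7}" "l \<in> {1..7}" "l \<le> n"
    using assms(2,3) by (rule bivectorsE)
  \<comment> \<open>The reversed forms make it possible to place the shared index on the inside,
    whichever position it has.\<close>
  have E': "E = - (A j ** A i)" using E anticommute[of i j] by simp
  have F': "F = - (A l ** A k)" using F anticommute[of k l] by simp
  have comm: "E ** A c = A c ** E" if "c \<in> {1..7}" "c \<notin> {i, j}" for c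
    using vector_bivector_commute[of c i j] that E by simp
  have anti: "E ** A c = - (A c ** E)" if "c \<in> {i, j}" for c
    using vector_bivector_anticommute[of c i j] that E by simp
  consider "k \<in> {i, j} \<longleftrightarrow> l \<in> {i, j}" | "k \<in> {i, j}" "l \<notin> {i, j}" | "k \<notin> {i, j}" "l \<in> {i, j}"
    by blast
  then show ?thesis
  proof cases
    case 1
    then have "E ** F = F ** E"
      unfolding F(1) using F comm anti anti_anti_mult commute_commute_mult by metis
    then show ?thesis by (simp add: acts_on_def)
  next
    case 2
    have "E ** F = - (F ** E)"
      unfolding F(1) by (intro anti_commute_mult anti comm F 2)
    moreover have "E ** F = A j ** A l" if "k = i"
      unfolding E' F(1) that by (simp add: matrix_minus contract[OF E(3)])
    moreover have "E ** F = - (A i ** A l)" if "k = j"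
      unfolding E(1) F(1) that by (simp add: matrix_minus contract[OF E(4)])
    ultimately show ?thesis
      using bivectors_pm[of j l n] bivectors_pm[of i l n] 2 E F by (auto simp: acts_on_def)
  next
    case 3
    have "E ** F = - (F ** E)"
      unfolding F(1) by (intro commute_anti_mult anti comm F 3)
    moreover have "E ** F = - (A j ** A k)" if "l = i"
      unfolding E' F' that by (simp add: matrix_minus contract[OF E(3)])
    moreover have "E ** F = A i ** A k" if "l = j"
      unfolding E(1) F' that by (simp add: matrix_minus contract[OF E(4)])
    ultimately show ?thesis
      using bivectors_pm[of j k n] bivectors_pm[of i k n] 3 E F by (auto simp: acts_on_def)
  qed
qed

text \<open>If \<open>k\<close> is an index of \<open>E\<close>, the product contracts to the other
  vector of \<open>E\<close> up to sign; otherwise the factors commute. Exchanging anticommuting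
  factors changes only the sign, so one computation serves both claims.\<close>

lemma acts_on_vectors:
  assumes "E \<in> bivectors n" "n \<le> 7" "k \<in> {1..7}"
  shows "acts_on E (A ` {1..n}) (A k)" "acts_on (A k) (A ` {1..n}) E"
proof -
  obtain i j where E: "E = A i ** A j" "i < j" "i \<in> {1..7}" "j \<in> {1..7}" "j \<le> n"
    using assms(1,2) by (rule bivectorsE)
  have mem: "A i \<in> A ` {1..n}" "A j \<in> A ` {1..n}" using E by auto
  have "A k ** E = E ** A k \<or>
      A k ** E = - (E ** A k) \<and> (A k ** E \<in> A ` {1..n} \<or> - (A k ** E) \<in> A ` {1..n})"
  proof (cases "k \<in> {i, j}")
    case True
    then have anti: "A k ** E = - (E ** A k)"
      using vector_bivector_anticommute[of k i j] E by simp
    have "A k ** E = - A j" if "k = i"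
      unfolding that E(1) by (rule contract_left[OF E(3)])
    moreover have "A k ** E = A i" if "k = j"
      using anti unfolding that E(1) by (simp add: contract_right[OF E(4)])
    ultimately have "A k ** E = - A j \<or> A k ** E = A i" using True by blast
    then have "A k ** E \<in> A ` {1..n} \<or> - (A k ** E) \<in> A ` {1..n}"
      using mem by (elim disjE) simp_all
    with anti show ?thesis by blast
  next
    case False
    then show ?thesis using vector_bivector_commute[of k i j] assms(3) E by simp
  qed
  then show "acts_on E (A ` {1..n}) (A k)" "acts_on (A k) (A ` {1..n}) E"
    unfolding acts_on_def by (metis add.inverse_inverse)+
qed

lemma vector_acts_on_vectors:
  assumes "k \<in> {1..7}" "m \<in> {1..7}"
  shows "acts_on (A k) (bivectors 7) (A m)"
  using assms bivectors_pm[of k m 7] anticommute[of k m]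
  by (cases "k = m") (auto simp: acts_on_def)

text \<open>Distinct generators are told apart by some \<open>A c\<close> that commutes with one and anticommutes
  with the other.\<close>

lemma separated:
  assumes "c \<in> {1..7}" "P ** A c = A c ** P" "Q ** A c = - (A c ** Q)" "P ** P = - mat 1"
  shows "P \<noteq> Q \<and> P \<noteq> - Q"
proof -
  have no: "P ** A c \<noteq> - (A c ** P)"
  proof
    assume "P ** A c = - (A c ** P)"
    then have "A c ** P = 0" using assms(2) by (simp add: eq_neg_iff_add_eq_0 flip: scaleR_2)
    \<comment> \<open>Multiplication by \<open>A c\<close> and \<open>P\<close> cancels both
      factors, since each squares to \<open>- mat 1\<close>, and leaves
      \<open>mat 1 = 0\<close>.\<close>
    then have "A c ** (A c ** P) ** P = 0" by (simp add: matrix_matrix_mult_def vec_eq_iff)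
    then show False
      using assms(1,4) by (simp add: contract_left matrix_minus mat_1_neq_0)
  qed
  have "P ** A c = - (A c ** P)" if "P = Q" using assms(3) unfolding that .
  moreover have "P ** A c = - (A c ** P)" if "P = - Q"
    unfolding that by (simp only: matrix_minus assms(3))
  ultimately show ?thesis using no by blast
qed

lemma bivector_square: "E \<in> bivectors n \<Longrightarrow> n \<le> 7 \<Longrightarrow> E ** E = - mat 1"
proof (erule bivectorsE, assumption)
  fix i j assume E: "E = A i ** A j" "i < j" "i \<in> {1..7}" "j \<in> {1..7}"
  then have "E = - (A j ** A i)" using anticommute[of i j] by simp
  then have "E ** E = (- (A j ** A i)) ** (A i ** A j)" using E(1) by (rule arg_cong2)
  also have "\<dots> = - mat 1"
    by (simp add: matrix_mult_minus_left contract[OF E(3)] square[OF E(4)])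
  finally show "E ** E = - mat 1" .
qed

lemma neg_neq: "P ** P = - mat 1 \<Longrightarrow> P \<noteq> - (P :: real^8^8)"
proof
  assume P: "P ** P = - mat 1" "P = - P"
  have "2 *\<^sub>R P = 0" unfolding scaleR_2 using P(2) by (rule iffD1[OF eq_neg_iff_add_eq_0])
  then have "P = 0" by simp
  with P(1) have "(mat 1 :: real^8^8) = 0" by (simp add: matrix_matrix_mult_def vec_eq_iff)
  then show False by (simp add: mat_1_neq_0)
qed

lemma bivectors_no_neg:
  assumes "E \<in> bivectors n" "F \<in> bivectors n" "n \<le> 7"
  shows "E \<noteq> - F"
proof -
  obtain i j where E: "E = A i ** A j" "i < j" "i \<in> {1..7}" "j \<in> {1..7}" "j \<le> n"
    using assms(1,3) by (rule bivectorsE)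
  obtain k l where F: "F = A k ** A l" "k < l" "k \<in> {1..7}" "l \<in> {1..7}" "l \<le> n"
    using assms(2,3) by (rule bivectorsE)
  \<comment> \<open>Both index pairs are increasing, so distinct bivectors have distinct index sets;
    an index of \<open>E\<close> that is not one of \<open>F\<close> then separates them.\<close>
  have "i = k \<and> j = l" if "{i, j} \<subseteq> {k, l}" using that E(2) F(2) by auto
  then consider "E = F" | c where "c \<in> {i, j}" "c \<notin> {k, l}"
    using E(1) F(1) by blast
  then show ?thesis
  proof cases
    case 1
    then show ?thesis using neg_neq[of E] bivector_square[OF assms(1,3)] by simp
  next
    case 2
    then have "F ** A c = A c ** F" "E ** A c = - (A c ** E)"
      using vector_bivector_commute[of c k l] vector_bivector_anticommute[of c i j] E F by auto
    moreover have "c \<in> {1..7}" using 2 E by auto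
    ultimately show ?thesis
      using separated[of c F E] bivector_square[OF assms(2,3)] by auto
  qed
qed

lemma vectors_no_neg: "k \<in> {1..7} \<Longrightarrow> m \<in> {1..7} \<Longrightarrow> A k \<noteq> - A m"
  using neg_neq[of "A k"] separated[of k "A k" "A m"] square[of k] anticommute[of m k]
  by (cases "k = m") auto

text \<open>Injectivity turns the sum over indices in \<open>sublaplacian_T6\<close> into a sum over
  a set of matrices.\<close>

lemma inj_vectors: "inj_on A {1..7}"
proof (rule inj_onI, rule ccontr)
  fix k m assume "k \<in> {1..7}" "m \<in> {1..7}" "A k = A m" "k \<noteq> m"
  then show False using separated[of k "A k" "A m"] square[of k] anticommute[of m k] by auto
qed

lemma vector_neq_bivector:
  assumes "E \<in> bivectors n" "n \<le> 7" "k \<in> {1..7}"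
  shows "A k \<noteq> E" "A k \<noteq> - E"
proof -
  obtain i j where E: "E = A i ** A j" "i < j" "i \<in> {1..7}" "j \<in> {1..7}" "j \<le> n"
    using assms(1,2) by (rule bivectorsE)
  \<comment> \<open>With seven indices available there is one outside \<open>{i, j, k}\<close>; its
    vector commutes with \<open>E\<close> and anticommutes with \<open>A k\<close>.\<close>
  have "\<exists>c\<in>{1..7::nat}. c \<notin> {i, j, k}"
  proof (rule ccontr)
    assume "\<not> ?thesis"
    then have "{1..7} \<subseteq> {i, j, k}" by blast
    from card_mono[OF _ this] show False by (simp add: card_insert_if split: if_splits)
  qed
  then obtain c where c: "c \<in> {1..7}" "c \<noteq> i" "c \<noteq> j" "c \<noteq> k" by auto
  have "E ** A c = A c ** E"
    using vector_bivector_commute[of c i j] E c by simp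
  from separated[OF c(1) this anticommute[OF assms(3) c(1)]] bivector_square[OF assms(1,2)] c
  show "A k \<noteq> E" "A k \<noteq> - E" by auto
qed

lemma transpose_bivector: "E \<in> bivectors n \<Longrightarrow> n \<le> 7 \<Longrightarrow> transpose E = - E"
proof (erule bivectorsE, assumption)
  fix i j assume E: "E = A i ** A j" "i < j" "i \<in> {1..7}" "j \<in> {1..7}"
  then show "transpose E = - E"
    using anticommute[of j i] by (simp add: matrix_transpose_mul skew matrix_minus)
qed

end

subsection \<open>Sums of squares on the sphere\<close>

text \<open>An operator identity for all smooth functions on all open sets, so that it can be
  applied again to \<open>linear_field E g\<close> and differentiated further.\<close>

definition commutes_with_sum_squares :: "real^8^8 \<Rightarrow> (real^8^8) set \<Rightarrow> bool" where
  "commutes_with_sum_squares E S \<longleftrightarrow> (\<forall>U g x. smooth_on U g \<longrightarrow> x \<in> U \<longrightarrow>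
    linear_field E (sum_squares S g) x = sum_squares S (linear_field E g) x)"

lemma sum_squares_sum:
  assumes "\<And>i. i \<in> I \<Longrightarrow> smooth_on U (f i)" "x \<in> U"
  shows "sum_squares S (\<lambda>y. \<Sum>i\<in>I. f i y) x = (\<Sum>i\<in>I. sum_squares S (f i) x)"
\<comment> \<open>Openness of \<open>U\<close> is drawn from the smoothness of some
  \<open>f i\<close>, which an empty \<open>I\<close> does not supply.\<close>
proof (cases "I = {}")
  case True
  have z: "linear_field A (\<lambda>y. 0) = (\<lambda>y. 0)" for A
    by (simp add: linear_field_def fun_eq_iff)
  show ?thesis using True by (simp add: sum_squares_def z)
next
  case False
  then have "open U" using assms(1) smooth_on_open by blast
  have "linear_field F (linear_field F (\<lambda>y. \<Sum>i\<in>I. f i y)) x =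
      (\<Sum>i\<in>I. linear_field F (linear_field F (f i)) x)" for F
  proof -
    have "linear_field F (linear_field F (\<lambda>y. \<Sum>i\<in>I. f i y)) x =
        linear_field F (\<lambda>y. \<Sum>i\<in>I. linear_field F (f i) y) x"
      by (rule linear_field_cong[OF smooth_on_linear_field[OF smooth_on_sum[OF \<open>open U\<close> assms(1)]]
            linear_field_sum[OF assms(1)] assms(2)])
    also have "\<dots> = (\<Sum>i\<in>I. linear_field F (linear_field F (f i)) x)"
      by (rule linear_field_sum[OF smooth_on_linear_field[OF assms(1)] assms(2)])
    finally show ?thesis .
  qed
  then show ?thesis by (simp add: sum_squares_def sum.swap[of _ I])
qed

text \<open>Each \<open>X(E)\<close> is moved past the sum over \<open>S\<close> twice, first on all
  of \<open>U\<close> and then at \<open>x\<close>; linearity of \<open>sum_squares S\<close>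
  collects the results over \<open>R\<close>.\<close>

lemma sum_squares_commute:
  assumes comm: "\<And>E. E \<in> R \<Longrightarrow> commutes_with_sum_squares E S"
    and g: "smooth_on U g" and x: "x \<in> U"
  shows "sum_squares R (sum_squares S g) x = sum_squares S (sum_squares R g) x"
proof -
  have "linear_field E (linear_field E (sum_squares S g)) x =
      sum_squares S (linear_field E (linear_field E g)) x" if "E \<in> R" for E
  proof -
    have "linear_field E (sum_squares S h) y = sum_squares S (linear_field E h) y"
      if "smooth_on U h" "y \<in> U" for h y
      using comm[OF \<open>E \<in> R\<close>] that unfolding commutes_with_sum_squares_def by blast
    then show ?thesis
      using linear_field_cong[OF smooth_on_linear_field[OF smooth_on_sum_squares[OF g]] _ x]
        smooth_on_linear_field[OF g] g x by metis
  qed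
  then have "sum_squares R (sum_squares S g) x =
      (\<Sum>E\<in>R. sum_squares S (linear_field E (linear_field E g)) x)"
    by (simp add: sum_squares_def[of R "sum_squares S g"])
  also have "\<dots> = sum_squares S (sum_squares R g) x"
    unfolding sum_squares_def[of R g, abs_def]
    by (rule sum_squares_sum[OF _ x, symmetric]) (intro smooth_on_linear_field g)
  finally show ?thesis .
qed

section \<open>Transfer from the ambient space to the sphere\<close>

lemma sphere_field_eq_linear_field:
  assumes "transpose A = - A" "smooth_on U g" "S7 \<subseteq> U" "\<And>y. y \<in> S7 \<Longrightarrow> f y = g y" "x \<in> S7"
  shows "sphere_field A f x = linear_field A g x"
  by (rule sphere_field_eq) (use assms in \<open>auto simp: smooth_extension_def\<close>)

text \<open>For skew \<open>E\<close>, \<open>linear_field E g\<close> is itself a smooth extension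
  of \<open>sphere_field E f\<close>, so the second application can be computed from it as
  well.\<close>

lemma sum_sphere_field_squares:
  assumes "\<And>E. E \<in> R \<Longrightarrow> transpose E = - E" "smooth_on U g" "S7 \<subseteq> U"
    and "\<And>y. y \<in> S7 \<Longrightarrow> f y = g y" "x \<in> S7"
  shows "(\<Sum>E\<in>R. (sphere_field E ^^ 2) f x) = sum_squares R g x"
proof -
  have "(sphere_field E ^^ 2) f x = linear_field E (linear_field E g) x" if "E \<in> R" for E
  proof -
    note E = assms(1)[OF that]
    show ?thesis
      using sphere_field_eq_linear_field[OF E smooth_on_linear_field[OF assms(2)] assms(3)
          sphere_field_eq_linear_field[OF E assms(2-4)] assms(5)]
      by (simp add: numeral_2_eq_2)
  qed
  then show ?thesis by (simp add: sum_squares_def)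
qed

text \<open>A smooth extension \<open>g\<close> of \<open>f\<close> yields extensions of
  \<open>P f\<close> and \<open>Q f\<close> on the same open set, where the ambient identity
  applies. The hypothesis is a disjunction because nestedness gives commutation for the members of
  one set only; the second conclusion accounts for the sign of the sublaplacian.\<close>

lemma commute_on_S7_sum_squares:
  assumes R: "\<And>E. E \<in> R \<Longrightarrow> transpose E = - E" and S: "\<And>E. E \<in> S \<Longrightarrow> transpose E = - E"
    and comm: "(\<forall>E\<in>R. commutes_with_sum_squares E S) \<or> (\<forall>E\<in>S. commutes_with_sum_squares E R)"
    and P: "\<And>f x. P f x = (\<Sum>E\<in>R. (sphere_field E ^^ 2) f x)"
    and Q: "\<And>f x. Q f x = (\<Sum>E\<in>S. (sphere_field E ^^ 2) f x)"
  shows "commute_on_S7 P Q" "commute_on_S7 P (\<lambda>f x. - Q f x)"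
proof -
  have *: "P (Q f) x = Q (P f) x \<and> P (\<lambda>x. - Q f x) x = - Q (P f) x"
    if f: "f \<in> C_inf_S7" and x: "x \<in> S7" for f x
  proof -
    obtain g U where U: "S7 \<subseteq> U" and g: "smooth_on U g" and fg: "\<And>y. y \<in> S7 \<Longrightarrow> f y = g y"
      using f by (auto simp: C_inf_S7_def smooth_extension_def)
    have xU: "x \<in> U" using x U by blast
    have sm: "smooth_on U (sum_squares T g)" for T using g by (rule smooth_on_sum_squares)
    have Pf: "P f y = sum_squares R g y" and Qf: "Q f y = sum_squares S g y" if "y \<in> S7" for y
      using sum_sphere_field_squares[OF R g U fg that] sum_sphere_field_squares[OF S g U fg that]
      by (simp_all add: P Q)
    have PQ: "P (Q f) x = sum_squares R (sum_squares S g) x"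
      using sum_sphere_field_squares[OF R sm U Qf x] by (simp add: P)
    have QP: "Q (P f) x = sum_squares S (sum_squares R g) x"
      using sum_sphere_field_squares[OF S sm U Pf x] by (simp add: Q)
    have eq: "sum_squares R (sum_squares S g) x = sum_squares S (sum_squares R g) x"
      using comm sum_squares_commute[of R S, OF _ g xU] sum_squares_commute[of S R, OF _ g xU]
      by auto
    have neg: "smooth_on U (\<lambda>y. - h y)" if "smooth_on U h" for h
      using smooth_on_mult[OF smooth_on_const[of U "-1"] that] smooth_on_open[OF g] by simp
    have "P (\<lambda>x. - Q f x) x = sum_squares R (\<lambda>y. - sum_squares S g y) x"
      using sum_sphere_field_squares[OF R neg[OF sm] U _ x, where f = "\<lambda>x. - Q f x"] Qf by (simp add: P)
    also have "\<dots> = - sum_squares R (sum_squares S g) x"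
    proof -
      have "linear_field E (linear_field E (\<lambda>y. - sum_squares S g y)) x =
          - linear_field E (linear_field E (sum_squares S g)) x" for E
      proof -
        note l = smooth_on_linear_field[OF sm, of E]
        have "linear_field E (linear_field E (\<lambda>y. - sum_squares S g y)) x =
            linear_field E (\<lambda>y. - linear_field E (sum_squares S g) y) x"
          by (rule linear_field_cong[OF smooth_on_linear_field[OF neg[OF sm]]
                linear_field_minus[OF sm] xU])
        then show ?thesis using linear_field_minus[OF l xU] by simp
      qed
      then show ?thesis by (simp add: sum_squares_def[of R] sum_negf)
    qed
    finally show ?thesis using PQ QP eq by simp
  qed
  then show "commute_on_S7 P Q" by (simp add: commute_on_S7_def)
  show "commute_on_S7 P (\<lambda>f x. - Q f x)" using * by (simp add: commute_on_S7_def)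
qed

context clifford_family
begin

lemma commutes_with_sum_squaresI:
  assumes "E ** E = - mat 1" "\<And>F. F \<in> S \<Longrightarrow> - F \<notin> S" "\<And>F. F \<in> S \<Longrightarrow> acts_on E S F"
  shows "commutes_with_sum_squares E S"
  unfolding commutes_with_sum_squares_def
proof (intro allI impI)
  fix U g x assume g: "smooth_on U g" and x: "(x :: real^8) \<in> U"
  show "linear_field E (sum_squares S g) x = sum_squares S (linear_field E g) x"
    by (rule linear_field_sum_squares_commute[OF g x],
        use assms(3) in \<open>auto simp: acts_on_def\<close>)
      (rule sum_bilinear_involution[OF bilinear_hessian[OF g x] hessian_sym[OF g x] assms(1,2)],
        use assms(3) in \<open>auto simp: acts_on_def\<close>)
qed

section \<open>The trace argument for \<open>A 7\<close>\<close>

lemma inner_vector: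
  assumes "i \<in> {1..7}"
  shows "(A i *v x) \<bullet> y = - (x \<bullet> (A i *v y))"
proof -
  have "x v* A i = - (A i *v x)"
    using transpose_matrix_vector[of "A i" x] skew[OF assms] by (simp add: matrix_minus)
  then show ?thesis using dot_lmul_matrix[of x "A i" y] by simp
qed

text \<open>The vectors \<open>x, A 1 x, \<dots>, A 7 x\<close> form an orthogonal basis: this is where the dimension
  \<open>8\<close> enters.\<close>

lemma sum_hessian_vectors:
  fixes H :: "real^8 \<Rightarrow> real^8 \<Rightarrow> real"
  assumes H: "bilinear H" and sym: "\<And>v w. H v w = H w v"
  shows "(\<Sum>k\<in>{1..6}. H ((A 7 ** A k) *v x) (A k *v x)) = 0"
proof (cases "x = 0")
  case True
  then show ?thesis using bilinear_lzero[OF H] by simp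
next
  case False
  define w where "w k = (if k = 0 then x else A k *v x)" for k :: nat
  define N where "N = x \<bullet> x"
  have N: "N > 0" using False by (simp add: N_def)
  have sk: "x \<bullet> (A i *v x) = 0" if "i \<in> {1..7}" for i
    using skew_inner_eq_0[OF skew[OF that]] .
  have sk2: "x \<bullet> (A i *v (A j *v x)) = (if i = j then - N else 0)"
    if "i \<in> {1..7}" "j \<in> {1..7}" for i j
  proof (cases "i = j")
    case True
    then show ?thesis
      using that by (simp add: matrix_vector_mul_assoc square matrix_minus N_def)
  next
    case False
    \<comment> \<open>Skewness makes this number symmetric in \<open>i\<close> and \<open>j\<close>,
      anticommutation makes it antisymmetric; hence it vanishes.\<close>
    have "x \<bullet> (A i *v (A j *v x)) = x \<bullet> (A j *v (A i *v x))"
      using inner_vector[OF that(1), of x "A j *v x"] inner_vector[OF that(2), of x "A i *v x"]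
      by (simp add: inner_commute)
    moreover have "A i *v (A j *v x) = - (A j *v (A i *v x))"
      unfolding matrix_vector_mul_assoc anticommute[OF that False] by (simp add: matrix_minus)
    ultimately show ?thesis using False by simp
  qed
  have ww: "w i \<bullet> w j = (if i = j then N else 0)" if "i \<in> {0..7}" "j \<in> {0..7}" for i j
  proof -
    have "(A i *v x) \<bullet> x = 0" if "i \<in> {1..7}" for i
      using sk[OF that] by (simp add: inner_commute)
    then show ?thesis
      using that sk[of j] sk2[of i j] inner_vector[of i x "A j *v x"]
      by (auto simp: w_def N_def)
  qed
  have expand: "y = (\<Sum>k\<in>{0..7}. (y \<bullet> w k / N) *\<^sub>R w k)" for y
  proof -
    have inj: "inj_on w {0..7}"
    proof (rule inj_onI)
      fix i j assume ij: "i \<in> {0..7}" "j \<in> {0..7}" "w i = w j"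
      then show "i = j" using ww[of i j] ww[of j j] N by (auto split: if_splits)
    qed
    have "pairwise orthogonal (w ` {0..7})"
      using ww by (auto simp: pairwise_def orthogonal_def)
    moreover have "0 \<notin> w ` {0..7}"
    proof
      assume "0 \<in> w ` {0..7}"
      then obtain k where "k \<in> {0..7}" "w k = 0" by auto
      then show False using ww[of k k] N by simp
    qed
    ultimately have "independent (w ` {0..7})" by (rule pairwise_orthogonal_independent)
    moreover have "card (w ` {0..7}) = 8" using card_image[OF inj] by simp
    ultimately have span: "UNIV \<subseteq> span (w ` {0..7})"
      by (intro card_ge_dim_independent) auto
    \<comment> \<open>The remainder \<open>z\<close> is orthogonal to every \<open>w i\<close>;
      these span the space, so \<open>z\<close> is orthogonal to itself.\<close>
    define z where "z = y - (\<Sum>k\<in>{0..7}. (y \<bullet> w k / N) *\<^sub>R w k)"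
    have "z \<bullet> w i = 0" if i: "i \<in> {0..7}" for i
    proof -
      have "(\<Sum>k\<in>{0..7}. (y \<bullet> w k / N) *\<^sub>R w k) \<bullet> w i =
          (\<Sum>k\<in>{0..7}. if k = i then y \<bullet> w i else 0)"
        unfolding inner_sum_left using ww[OF _ i] N by (intro sum.cong) auto
      also have "\<dots> = y \<bullet> w i" using i by (simp add: sum.delta)
      finally show ?thesis by (simp add: z_def inner_diff_left)
    qed
    then have "orthogonal z v" if "v \<in> w ` {0..7}" for v
      using that by (auto simp: orthogonal_def)
    then have "orthogonal z z"
      using orthogonal_to_span[of z "w ` {0..7}" z] span by blast
    then show ?thesis by (simp add: orthogonal_self z_def)
  qed
  \<comment> \<open>The matrix of \<open>A 7\<close> in the orthogonal basis \<open>w\<close>; it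
    inherits skew-symmetry.\<close>
  define c where "c k l = ((A 7 *v w k) \<bullet> w l) / N" for k l
  have anti: "c k l = - c l k" for k l
    using inner_vector[of 7 "w k" "w l"] by (simp add: c_def inner_commute)
  have lin: "linear (\<lambda>v. H v u)" for u using H by (simp add: bilinear_def)
  have "H (A 7 *v w k) (w k) = (\<Sum>l\<in>{0..7}. c k l * H (w l) (w k))" for k
  proof -
    have "H (A 7 *v w k) (w k) = H (\<Sum>l\<in>{0..7}. c k l *\<^sub>R w l) (w k)"
      using expand[of "A 7 *v w k"] by (simp add: c_def)
    also have "\<dots> = (\<Sum>l\<in>{0..7}. H (c k l *\<^sub>R w l) (w k))" by (rule linear_sum[OF lin])
    also have "\<dots> = (\<Sum>l\<in>{0..7}. c k l * H (w l) (w k))"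
      by (simp add: linear_scale[OF lin])
    finally show ?thesis .
  qed
  then have total: "(\<Sum>k\<in>{0..7}. H (A 7 *v w k) (w k)) =
      (\<Sum>k\<in>{0..7}. \<Sum>l\<in>{0..7}. c k l * H (w l) (w k))" by simp
  also have "\<dots> = (\<Sum>l\<in>{0..7}. \<Sum>k\<in>{0..7}. c k l * H (w l) (w k))" by (rule sum.swap)
  also have "\<dots> = (\<Sum>l\<in>{0..7}. \<Sum>k\<in>{0..7}. - (c l k * H (w k) (w l)))"
    by (intro sum.cong refl) (metis anti sym mult_minus_left)
  also have "\<dots> = - (\<Sum>k\<in>{0..7}. H (A 7 *v w k) (w k))"
    by (simp only: total sum_negf)
  finally have zero: "(\<Sum>k\<in>{0..7}. H (A 7 *v w k) (w k)) = 0" by simp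
  \<comment> \<open>The terms for \<open>k = 0\<close> and \<open>k = 7\<close> are
    \<open>H (A 7 *v x) x\<close> and \<open>H (- x) (A 7 *v x)\<close>. They cancel and leave the
    sum over \<open>{1..6}\<close>.\<close>
  have "{0..7} = insert 0 (insert 7 {1..6::nat})" by auto
  then have "(\<Sum>k\<in>{0..7}. H (A 7 *v w k) (w k)) =
      H (A 7 *v x) x + (H (A 7 *v (A 7 *v x)) (A 7 *v x) + (\<Sum>k\<in>{1..6}. H (A 7 *v w k) (w k)))"
    by (simp add: w_def)
  moreover have "A 7 *v (A 7 *v x) = - x"
    by (simp add: matrix_vector_mul_assoc square matrix_minus)
  moreover have "(\<Sum>k\<in>{1..6}. H (A 7 *v w k) (w k)) =
      (\<Sum>k\<in>{1..6}. H ((A 7 ** A k) *v x) (A k *v x))"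
    by (intro sum.cong) (auto simp: w_def matrix_vector_mul_assoc)
  ultimately show ?thesis
    using zero sym[of "A 7 *v x" x] by (simp add: bilinear_lneg[OF H])
qed

lemma seventh_vector_commutes: "commutes_with_sum_squares (A 7) (A ` {1..6})"
  unfolding commutes_with_sum_squares_def
proof (intro allI impI)
  fix U g x assume g: "smooth_on U g" and x: "(x :: real^8) \<in> U"
  have anti: "A 7 ** A k = - (A k ** A 7)" "A 7 ** A k \<noteq> A k ** A 7" if "k \<in> {1..6}" for k
  proof -
    show *: "A 7 ** A k = - (A k ** A 7)" using that by (intro anticommute) auto
    have "A k ** A 7 \<in> bivectors 7" using that by (intro bivectorsI) auto
    then show "A 7 ** A k \<noteq> A k ** A 7"
      unfolding * using bivectors_no_neg[of "A k ** A 7" 7 "A k ** A 7"] by force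
  qed
  have "inj_on A {1..6}" by (rule inj_on_subset[OF inj_vectors]) auto
  then have "(\<Sum>F\<in>A ` {1..6}. if A 7 ** F = F ** A 7 then 0 else hessian g x ((A 7 ** F) *v x) (F *v x))
      = (\<Sum>k\<in>{1..6}. hessian g x ((A 7 ** A k) *v x) (A k *v x))"
    unfolding sum.reindex[OF \<open>inj_on A {1..6}\<close>] o_def by (intro sum.cong) (auto simp: anti(2))
  also have "\<dots> = 0"
    by (rule sum_hessian_vectors[OF bilinear_hessian[OF g x] hessian_sym[OF g x]])
  finally show "linear_field (A 7) (sum_squares (A ` {1..6}) g) x =
      sum_squares (A ` {1..6}) (linear_field (A 7) g) x"
    by (intro linear_field_sum_squares_commute[OF g x]) (use anti(1) in auto)
qed

section \<open>The generating sets\<close>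

lemma gen_set_cases:
  assumes "l \<in> {1..7}"
  obtains "l \<le> 5" "gen_set A l = bivectors (l + 1)"
  | "l = 6" "gen_set A l = bivectors 6 \<union> {A 7}"
  | "l = 7" "gen_set A l = bivectors 7 \<union> A ` {1..7}"
proof -
  have "{A k | k. 1 \<le> k \<and> k \<le> 7} = A ` {1..7}" by auto
  moreover have "l \<le> 5 \<or> l = 6 \<or> l = 7" using assms by auto
  ultimately show ?thesis
    using that by (auto simp: gen_set_def bivectors_def)
qed

lemma gen_set_subset: "l \<in> {1..7} \<Longrightarrow> gen_set A l \<subseteq> bivectors 7 \<union> A ` {1..7}"
  using bivectors_mono[of "l + 1" 7] bivectors_mono[of 6 7] by (erule_tac gen_set_cases) auto

lemma gen_set_mono:
  assumes "m \<in> {1..7}" "l \<in> {1..7}" "m \<le> l"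
  shows "gen_set A m \<subseteq> gen_set A l"
  using assms(1)
proof (cases rule: gen_set_cases)
  case 1
  with assms(2) show ?thesis
  proof (cases rule: gen_set_cases)
    case 1
    then show ?thesis using \<open>gen_set A m = _\<close> assms(3) bivectors_mono[of "m + 1" "l + 1"] by simp
  next
    case 2
    then show ?thesis using \<open>gen_set A m = _\<close> \<open>m \<le> 5\<close> bivectors_mono[of "m + 1" 6] by auto
  next
    case 3
    then show ?thesis using \<open>gen_set A m = _\<close> \<open>m \<le> 5\<close> bivectors_mono[of "m + 1" 7] by auto
  qed
next
  case 2
  with assms(2) show ?thesis
    using assms(3) bivectors_mono[of 6 7] by (cases rule: gen_set_cases) auto
next
  case 3
  then show ?thesis using assms by auto
qed

lemma gen_set_skew: "l \<in> {1..7} \<Longrightarrow> E \<in> gen_set A l \<Longrightarrow> transpose E = - E"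
  using gen_set_subset[of l] transpose_bivector[of E 7] skew by blast

lemma gen_set_square: "l \<in> {1..7} \<Longrightarrow> E \<in> gen_set A l \<Longrightarrow> E ** E = - mat 1"
  using gen_set_subset[of l] bivector_square[of E 7] square by blast

lemma gen_set_no_neg:
  assumes "l \<in> {1..7}" "F \<in> gen_set A l"
  shows "- F \<notin> gen_set A l"
proof
  assume "- F \<in> gen_set A l"
  then have "F \<in> bivectors 7 \<union> A ` {1..7}" "- F \<in> bivectors 7 \<union> A ` {1..7}"
    using assms gen_set_subset by blast+
  then show False
    using bivectors_no_neg[of "- F" 7 F] vectors_no_neg vector_neq_bivector[of F 7]
      vector_neq_bivector[of "- F" 7] by fastforce
qed

text \<open>For \<open>l = 6\<close>, \<open>A 7\<close> commutes with all bivectors on the first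
  six indices. For \<open>l = 7\<close>, noncommuting products of two bivectors or of two vectors
  are bivectors, and mixed ones are vectors, up to sign.\<close>

lemma gen_set_acts_on:
  assumes "l \<in> {1..7}" "E \<in> gen_set A l" "F \<in> gen_set A l"
  shows "acts_on E (gen_set A l) F"
  using assms(1)
proof (cases rule: gen_set_cases)
  case 1
  then show ?thesis using assms acts_on_bivectors by simp
next
  case 2
  have comm: "A 7 ** B = B ** A 7" if B: "B \<in> bivectors 6" for B
  proof -
    obtain i j where "B = A i ** A j" "i < j" "i \<in> {1..7}" "j \<in> {1..7}" "j \<le> 6"
      using B by (rule bivectorsE) simp_all
    then show ?thesis using vector_bivector_commute[of 7 i j] by simp
  qed
  show ?thesis
  proof (cases "E \<in> bivectors 6 \<and> F \<in> bivectors 6")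
    case True
    then have "acts_on E (bivectors 6) F" using acts_on_bivectors[of E 6 F] by simp
    then show ?thesis by (rule acts_on_mono) (use 2 in auto)
  next
    case False
    then have "E ** F = F ** E" using assms 2 comm by force
    then show ?thesis by (simp add: acts_on_def)
  qed
next
  case 3
  have "acts_on E (bivectors 7) F \<or> acts_on E (A ` {1..7}) F"
    using assms(2,3) unfolding 3(2)
    using acts_on_bivectors[of E 7 F] acts_on_vectors[of E 7] acts_on_vectors[of F 7]
      vector_acts_on_vectors by blast
  then show ?thesis using acts_on_mono 3 by blast
qed

lemma gen_set_commutes:
  assumes "m \<in> {1..7}" "l \<in> {1..7}" "m \<le> l" "E \<in> gen_set A m"
  shows "commutes_with_sum_squares E (gen_set A l)"
proof -
  have "E \<in> gen_set A l" using gen_set_mono assms by blast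
  then show ?thesis
    by (intro commutes_with_sum_squaresI)
      (use assms(2) gen_set_square gen_set_no_neg gen_set_acts_on in auto)
qed

lemma gen_set_commutes_vectors:
  assumes "l \<in> {1..6}" "E \<in> gen_set A l"
  shows "commutes_with_sum_squares E (A ` {1..6})"
proof -
  have l: "l \<in> {1..7}" using assms by auto
  have "commutes_with_sum_squares E (A ` {1..6})" if E: "E \<in> bivectors 6"
  proof (rule commutes_with_sum_squaresI)
    show "E ** E = - mat 1" using bivector_square[OF E] by simp
    show "acts_on E (A ` {1..6}) F" if "F \<in> A ` {1..6}" for F
      using that acts_on_vectors(1)[OF E] by auto
    show "- F \<notin> A ` {1..6}" if "F \<in> A ` {1..6}" for F
      using that vectors_no_neg by force
  qed
  moreover have "E \<in> bivectors 6 \<union> {A 7}"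
    using l
  proof (cases rule: gen_set_cases)
    case 1
    then show ?thesis using bivectors_mono[of "l + 1" 6] assms by auto
  qed (use assms in auto)
  ultimately show ?thesis using seventh_vector_commutes by blast
qed

lemma vectors_commute_gen_set_7: "k \<in> {1..7} \<Longrightarrow> commutes_with_sum_squares (A k) (gen_set A 7)"
  by (rule gen_set_commutes[of 7 7]) (auto simp: gen_set_def)

end

theorem proposition6p4:
  fixes A :: "nat \<Rightarrow> real^8^8"
  assumes skew: "\<And>i. i \<in> {1..7} \<Longrightarrow> transpose (A i) = - A i"
    and clifford: "\<And>i j. i \<in> {1..7} \<Longrightarrow> j \<in> {1..7} \<Longrightarrow>
      A i ** A j + A j ** A i = (if i = j then - 2 else 0) *\<^sub>R mat 1"
  shows "(\<forall>l\<in>{1..7}. \<forall>m\<in>{1..7}. commute_on_S7 (K_op A l) (K_op A m)) \<and>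
    (\<forall>l\<in>{1..7}. commute_on_S7 (K_op A l) (sublaplacian_T6 A))"
proof -
  interpret clifford_family A by unfold_locales (fact skew clifford)+
  have K: "commute_on_S7 (K_op A l) (K_op A m)" if "l \<in> {1..7}" "m \<in> {1..7}" for l m
  proof (rule commute_on_S7_sum_squares(1)[OF gen_set_skew[OF that(1)] gen_set_skew[OF that(2)]])
    \<comment> \<open>The smaller index supplies the single fields, the larger one the sum of
      squares.\<close>
    show "(\<forall>E\<in>gen_set A l. commutes_with_sum_squares E (gen_set A m)) \<or>
        (\<forall>E\<in>gen_set A m. commutes_with_sum_squares E (gen_set A l))"
      using gen_set_commutes[OF that] gen_set_commutes[OF that(2,1)] by (cases "l \<le> m") auto
  qed (simp_all add: K_op_def)
  have inj: "inj_on A {1..6}" by (rule inj_on_subset[OF inj_vectors]) auto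
  have T: "sublaplacian_T6 A = (\<lambda>f x. - (\<Sum>E\<in>A ` {1..6}. (sphere_field E ^^ 2) f x))"
    unfolding sum.reindex[OF inj] by (simp add: fun_eq_iff sublaplacian_T6_def)
  have "commute_on_S7 (K_op A l) (sublaplacian_T6 A)" if l: "l \<in> {1..7}" for l
    unfolding T
  proof (rule commute_on_S7_sum_squares(2)[OF gen_set_skew[OF l]])
    show "transpose E = - E" if "E \<in> A ` {1..6}" for E using that skew by auto
    show "(\<forall>E\<in>gen_set A l. commutes_with_sum_squares E (A ` {1..6})) \<or>
        (\<forall>E\<in>A ` {1..6}. commutes_with_sum_squares E (gen_set A l))"
    proof (cases "l = 7")
      case True
      then show ?thesis using vectors_commute_gen_set_7 by auto
    next
      case False
      then show ?thesis using gen_set_commutes_vectors[of l] l by auto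
    qed
  qed (simp_all add: K_op_def)
  with K show ?thesis by blast
qed

end
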